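(* Let $n\ge 1$ and $k$ be odd integers with $1\le k\le n$. Among the $2^n$ assignments of over/under data to the crossings of the free $n$-foil, exactly $\binom{n}{\frac{n-k}{2}}$ produce left $k$-foils and exactly $\binom{n}{\frac{n-k}{2}}$ produce right $k$-foils. (Here a knot and its mirror image are counted as distinct; for $k=1$ the left and right $1$-foils are the two one-crossing diagrams left after cancelling crossings in pairs, both of which represent the unknot, so that the unknot is produced by $2\binom{n}{\frac{n-1}{2}}$ assignments in total.)
   Context: For odd $n$, the free $n$-foil is the planar closed curve with $n$ double points obtained as follows: take two parallel horizontal strands and let them cross each other $n$ times in a row (a horizontal row of $n$ crossings, with two left ends and two right ends), then join the upper-left end to the upper-right end by an arc passing above the row, and the lower-left end to the lower-right end by an arc passing below the row, with no further crossings. An assignment is a choice of overstrand at each of the $n$ crossings. A crossing in the row is of positive slope type if its overstrand has positive slope, and of negative slope type otherwise. The right and left $k$-foils ($k$ odd) are the two knots obtained from the free $k$-foil by making all $k$ crossings of the same slope type (the two choices of type give mirror-image knots); the $3$-foil is the trefoil, and the $1$-foil is the unknot. *)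

theory Defs
  imports Main "HOL-Library.FuncSet"
begin

text \<open>
  Knot diagrams are written in Morse position and read from left to right. A vertical line in general
  position meets the diagram in finitely many strands, numbered \<open>0, 1, 2, \<dots>\<close> from top to bottom,
  and a diagram is the list of its elementary pieces in the order in which they are met. The number
  paired with a piece is the number of strands that pass above it. The parameter \<open>'c\<close> is the
  information carried by a crossing: a mere name in the underlying plane curve, the slope of the
  overstrand in a knot diagram.
\<close>

datatype 'c piece =
    Lturn           \<comment> \<open>leftmost point of an arc: two strands start here\<close>
  | Rturn           \<comment> \<open>rightmost point of an arc: two strands end here\<close>
  | Crossing 'c     \<comment> \<open>two neighbouring strands cross\<close>

type_synonym 'c picture = "('c piece \<times> nat) list"

fun ins :: "'c piece \<Rightarrow> nat" where
  "ins Lturn = 0"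
| "ins Rturn = 2"
| "ins (Crossing _) = 2"

fun outs :: "'c piece \<Rightarrow> nat" where
  "outs Lturn = 2"
| "outs Rturn = 0"
| "outs (Crossing _) = 2"

text \<open>\<open>tangle w m m'\<close>: \<open>w\<close> is a legal picture with \<open>m\<close> left ends and \<open>m'\<close> right ends.\<close>

fun tangle :: "'c picture \<Rightarrow> nat \<Rightarrow> nat \<Rightarrow> bool" where
  "tangle [] m m' \<longleftrightarrow> m = m'"
| "tangle ((p, i) # w) m m' \<longleftrightarrow> i + ins p \<le> m \<and> tangle w (m - ins p + outs p) m'"

definition closed_picture :: "'c picture \<Rightarrow> bool" where
  "closed_picture w \<longleftrightarrow> tangle w 0 0"

datatype slope = Positive | Negative   \<comment> \<open>slope of the overstrand\<close>

fun opposite :: "slope \<Rightarrow> slope" where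
  "opposite Positive = Negative"
| "opposite Negative = Positive"

type_synonym diagram = "slope picture"

text \<open>
  The first five rules are the planar isotopies of diagrams in Morse position: pieces far apart
  vertically may be passed in either order, a zigzag may be straightened, and a strand may be slid
  across a turning point (where the slope of that strand, hence the slope type of its crossing,
  changes sign). The others are the Reidemeister moves. In \<open>R3\<close> the strands starting in the
  positions \<open>i\<close>, \<open>i + 1\<close>, \<open>i + 2\<close> cross pairwise, with slope type \<open>a\<close> for the first two, \<open>b\<close> for the
  outer two and \<open>c\<close> for the last two; the side condition excludes exactly the two cyclic patterns,
  in which no strand lies above both others. Together these rules generate ambient isotopy of
  unoriented links in 3-space (Reidemeister; for diagrams in Morse position: Freyd and Yetter,
  Turaev). Mirror images are not identified.
\<close>

inductive local_move :: "diagram \<Rightarrow> diagram \<Rightarrow> bool" where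
  exchange: "local_move [(p, i), (q, i + outs p + d)] [(q, i + ins p + d), (p, i)]"
| zigzag_down: "local_move [(Lturn, i), (Rturn, i + 1)] []"
| zigzag_up: "local_move [(Lturn, i + 1), (Rturn, i)] []"
| slide_Lturn:
    "local_move [(Lturn, i), (Crossing s, i + 1)] [(Lturn, i + 1), (Crossing (opposite s), i)]"
| slide_Rturn:
    "local_move [(Crossing s, i + 1), (Rturn, i)] [(Crossing (opposite s), i), (Rturn, i + 1)]"
| R1_Lturn: "local_move [(Lturn, i), (Crossing s, i)] [(Lturn, i)]"
| R1_Rturn: "local_move [(Crossing s, i), (Rturn, i)] [(Rturn, i)]"
| R2: "local_move [(Crossing s, i), (Crossing (opposite s), i)] []"
| R3: "b = a \<or> b = c \<Longrightarrow>
    local_move [(Crossing a, i), (Crossing b, i + 1), (Crossing c, i)]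
               [(Crossing c, i + 1), (Crossing b, i), (Crossing a, i + 1)]"

inductive move :: "diagram \<Rightarrow> diagram \<Rightarrow> bool" where
  "local_move l r \<Longrightarrow> closed_picture (u @ l @ v) \<Longrightarrow> closed_picture (u @ r @ v) \<Longrightarrow>
   move (u @ l @ v) (u @ r @ v)"

definition same_knot :: "diagram \<Rightarrow> diagram \<Rightarrow> bool" where
  "same_knot = equivclp move"

definition unknot :: diagram where
  "unknot = [(Lturn, 0), (Rturn, 0)]"

text \<open>
  In the free \<open>n\<close>-foil the strands \<open>1\<close> and \<open>2\<close> form the horizontal row of crossings, named
  \<open>0, \<dots>, n - 1\<close> from left to right. Strand \<open>0\<close> is the arc above the row, joining its two upper ends,
  and strand \<open>3\<close> the arc below it, joining its two lower ends.
\<close>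

definition free_foil :: "nat \<Rightarrow> nat picture" where
  "free_foil n = [(Lturn, 0), (Lturn, 2)] @ map (\<lambda>j. (Crossing j, 1)) [0..<n] @
                 [(Rturn, 2), (Rturn, 0)]"

definition assignments :: "nat \<Rightarrow> (nat \<Rightarrow> slope) set" where
  "assignments n = {..<n} \<rightarrow>\<^sub>E UNIV"

definition resolve :: "('c \<Rightarrow> slope) \<Rightarrow> 'c picture \<Rightarrow> diagram" where
  "resolve a w = map (map_prod (map_piece a) id) w"

text \<open>
  For odd \<open>k\<close> both strands of the row run in the same direction along the knot, so a crossing of
  positive slope type is a negative crossing in the usual sense (the overstrand is turned clockwise
  to the understrand). Hence positive slopes give the left-handed foil.
\<close>

definition left_foil :: "nat \<Rightarrow> diagram" where
  "left_foil k = resolve (\<lambda>_. Positive) (free_foil k)"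

definition right_foil :: "nat \<Rightarrow> diagram" where
  "right_foil k = resolve (\<lambda>_. Negative) (free_foil k)"

text \<open>Cancelling two neighbouring crossings of opposite slope types, without any other move.\<close>

inductive cancel_pair :: "diagram \<Rightarrow> diagram \<Rightarrow> bool" where
  "cancel_pair (u @ [(Crossing s, i), (Crossing (opposite s), i)] @ v) (u @ v)"

text \<open>
  \<open>produces D F k\<close>: the diagram \<open>D\<close> produces the \<open>k\<close>-foil with standard diagram \<open>F\<close>. Foils are
  compared as knots, except that the left and the right \<open>1\<close>-foil, which are the same knot,
  are compared as the one-crossing diagrams that remain after cancelling crossings in pairs.
\<close>

definition produces :: "diagram \<Rightarrow> diagram \<Rightarrow> nat \<Rightarrow> bool" where
  "produces D F k \<longleftrightarrow> (if k = 1 then cancel_pair\<^sup>*\<^sup>* D F else same_knot D F)"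

lemma closed_picture_free_foil: "closed_picture (free_foil n)"
proof -
  have "tangle (map (\<lambda>j. (Crossing j, 1)) js @ w) 4 0 = tangle w 4 0"
    for js :: "nat list" and w
    by (induction js) auto
  from this[of "[0..<n]" "[(Rturn, 2), (Rturn, 0)]"]
  show ?thesis by (simp add: closed_picture_def free_foil_def eval_nat_numeral)
qed

lemma closed_picture_resolve: "closed_picture (resolve a w) = closed_picture w"
proof -
  have *: "ins (map_piece a p) = ins p" "outs (map_piece a p) = outs p" for p
    by (cases p; simp)+
  have "tangle (resolve a w) m m' = tangle w m m'" for m m'
    by (induction w m m' rule: tangle.induct) (auto simp: resolve_def *)
  then show ?thesis by (simp add: closed_picture_def)
qed

end

theory Submission
  imports Defs Complex_Main
begin

text \<open>
  Cancelling neighbouring crossings of opposite slope types leaves a row of \<open>k\<close> crossings of one slope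
  type, where \<open>\<plusminus>k\<close> is the number of positive minus the number of negative crossings; so the count
  reduces to binomial coefficients once the remaining foils are told apart. This is done by the
  Kauffman bracket at \<open>A = 2\<close>, computed as a tensor contraction with a two-dimensional space attached to
  each strand. It is invariant up to the factors \<open>- A ^ 3 = - 8\<close> and \<open>- 1 / 8\<close> caused by curls, so
  the odd part of its numerator is a knot invariant and no writhe or orientation is needed.
  On the foils its values are \<open>17\<close> for \<open>k = 1\<close> and, for \<open>k \<ge> 3\<close>, \<open>273 * 16 ^ (k - 1) - 1\<close> (left)
  and \<open>16 ^ (k + 1) - 273\<close> (right), which are distinct: the two kinds differ modulo \<open>256\<close>.
\<close>

section \<open>The bracket\<close>

text \<open>The matrices \<open>cap\<close> and \<open>cup\<close> are inverse to each other, which straightens zigzags, and a loop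
  has the value \<open>- 4 - 1 / 4 = - A\<^sup>2 - 1 / A\<^sup>2\<close> of the bracket.\<close>

fun cap :: "bool \<Rightarrow> bool \<Rightarrow> rat" where
  "cap False True = 2"
| "cap True False = - 1 / 2"
| "cap _ _ = 0"

fun cup :: "bool \<Rightarrow> bool \<Rightarrow> rat" where
  "cup False True = - 2"
| "cup True False = 1 / 2"
| "cup _ _ = 0"

fun wt :: "slope \<Rightarrow> rat" where
  "wt Positive = 2"
| "wt Negative = 1 / 2"

text \<open>A crossing obeys Kauffman's skein relation: \<open>wt s\<close>, which is
  \<open>A\<close> or \<open>1 / A\<close>, times the smoothing with two through strands, plus
  \<open>1 / wt s\<close> times a right turn followed by a left turn. The first list labels left
  ends, the second right ends.\<close>

fun entry :: "slope piece \<Rightarrow> bool list \<Rightarrow> bool list \<Rightarrow> rat" where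
  "entry Lturn [] [c, d] = cup c d"
| "entry Rturn [a, b] [] = cap a b"
| "entry (Crossing s) [a, b] [c, d] =
    (if a = c \<and> b = d then wt s else 0) + cap a b * cup c d / wt s"
| "entry _ _ _ = 0"

text \<open>Functions of the labels to the right of a piece become functions of the labels to its
  left, so operators compose in reading order.\<close>

definition step :: "slope piece \<Rightarrow> nat \<Rightarrow> (bool list \<Rightarrow> rat) \<Rightarrow> bool list \<Rightarrow> rat" where
  "step p i g xs = (\<Sum>cs | length cs = outs p.
     entry p (take (ins p) (drop i xs)) cs * g (take i xs @ cs @ drop (i + ins p) xs))"

definition act :: "diagram \<Rightarrow> (bool list \<Rightarrow> rat) \<Rightarrow> bool list \<Rightarrow> rat" where
  "act w = foldr (\<lambda>(p, i). step p i) w"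

text \<open>A closed picture has no ends, so the constant function is only evaluated at
  \<open>[]\<close>. The value is not normalized: the unknot gets \<open>- 17 / 4\<close>.\<close>

definition bracket :: "diagram \<Rightarrow> rat" where
  "bracket D = act D (\<lambda>_. 1) []"

lemma act_simps [simp]:
  "act [] g = g"
  "act ((p, i) # w) g = step p i (act w g)"
  "act (u @ w) g = act u (act w g)"
  by (simp_all add: act_def)

lemma step_append:
  assumes "length us = i" "length as = ins p"
  shows "step p i g (us @ as @ vs) =
    (\<Sum>cs | length cs = outs p. entry p as cs * g (us @ cs @ vs))"
  using assms by (simp add: step_def)

lemma sum_length_2:
  "(\<Sum>cs | length cs = 2. f cs) =
     f [False, False] + f [False, True] + f [True, False] + (f [True, True] :: rat)"
proof -
  have "{cs :: bool list. length cs = 2} =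
      {[False, False], [False, True], [True, False], [True, True]}"
    by (auto simp: numeral_2_eq_2 length_Suc_conv)
  then show ?thesis by simp
qed

text \<open>Only two label pairs survive, as \<open>cup\<close> vanishes on equal labels. Written
  with explicit labels, the local identities below become case splits followed by
  arithmetic.\<close>

lemma step_pieces:
  assumes "length us = i"
  shows "step Lturn i g (us @ vs) =
      g (us @ True # False # vs) / 2 - 2 * g (us @ False # True # vs)"
    and "step Rturn i g (us @ a # b # vs) = cap a b * g (us @ vs)"
    and "step (Crossing s) i g (us @ a # b # vs) = wt s * g (us @ a # b # vs) +
      cap a b / wt s * (g (us @ True # False # vs) / 2 - 2 * g (us @ False # True # vs))"
proof -
  show "step Lturn i g (us @ vs) =
      g (us @ True # False # vs) / 2 - 2 * g (us @ False # True # vs)"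
    using step_append[of us i "[]" Lturn g vs] assms by (simp add: sum_length_2)
  show "step Rturn i g (us @ a # b # vs) = cap a b * g (us @ vs)"
    using step_append[of us i "[a, b]" Rturn g vs] assms by simp
  show "step (Crossing s) i g (us @ a # b # vs) = wt s * g (us @ a # b # vs) +
      cap a b / wt s * (g (us @ True # False # vs) / 2 - 2 * g (us @ False # True # vs))"
    using step_append[of us i "[a, b]" "Crossing s" g vs] assms
    by (cases a; cases b; cases s) (simp_all add: sum_length_2 algebra_simps)
qed

text \<open>Overlapping pieces of a local move can thus be evaluated over one common prefix
  \<open>us\<close>.\<close>

lemma step_pieces_Suc:
  assumes "length us = i"
  shows "step Lturn (Suc i) g (us @ x # vs) =
      g (us @ x # True # False # vs) / 2 - 2 * g (us @ x # False # True # vs)"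
    and "step Rturn (Suc i) g (us @ x # a # b # vs) = cap a b * g (us @ x # vs)"
    and "step (Crossing s) (Suc i) g (us @ x # a # b # vs) = wt s * g (us @ x # a # b # vs) +
      cap a b / wt s *
        (g (us @ x # True # False # vs) / 2 - 2 * g (us @ x # False # True # vs))"
  using step_pieces[of "us @ [x]" "Suc i"] assms by simp_all

section \<open>Ends of tangles; linearity and locality of the action\<close>

lemma tangle_append:
  "tangle (u @ w) m m' \<longleftrightarrow> (\<exists>k. tangle u m k \<and> tangle w k m')"
  by (induction u m m' rule: tangle.induct) auto

lemma tangle_functional: "tangle w m k \<Longrightarrow> tangle w m k' \<Longrightarrow> k = k'"
  by (induction w m k rule: tangle.induct) auto

text \<open>The operators are linear and consult \<open>g\<close> only on lists with as many labels
  as there are right ends. This carries a scalar identity through the part of a diagram left of a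
  local move.\<close>

lemma act_cong_scaled:
  assumes "tangle w m m'" "length xs = m" "\<And>ys. length ys = m' \<Longrightarrow> g ys = c * h ys"
  shows "act w g xs = c * act w h xs"
  using assms
proof (induction w m m' arbitrary: xs rule: tangle.induct)
  case (2 p i w m m')
  have "act w g (take i xs @ cs @ drop (i + ins p) xs) =
      c * act w h (take i xs @ cs @ drop (i + ins p) xs)" if "length cs = outs p" for cs
    using 2 that by (intro "2.IH") auto
  then show ?case
    by (simp add: step_def sum_distrib_left mult.left_commute)
qed simp

lemma split_at:
  fixes xs :: "'a list"
  assumes "i + j \<le> length xs"
  obtains us as vs where "xs = us @ as @ vs" "length us = i" "length as = j"
proof
  show "xs = take i xs @ take j (drop i xs) @ drop (i + j) xs"
    by (metis append_take_drop_id drop_drop add.commute)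
qed (use assms in auto)

text \<open>The pieces act on disjoint blocks of labels, \<open>as\<close> and \<open>bs\<close>, so
  both sides are one double sum taken in the two orders.\<close>

lemma step_exchange:
  assumes "i + ins p + d + ins q \<le> length xs"
  shows "step p i (step q (i + outs p + d) g) xs = step q (i + ins p + d) (step p i g) xs"
proof -
  obtain us as ys where xs: "xs = us @ as @ ys" and l: "length us = i" "length as = ins p"
    using split_at[of i "ins p" xs] assms by (metis add_leD1)
  obtain ms bs vs where ys: "ys = ms @ bs @ vs" and l': "length ms = d" "length bs = ins q"
    using split_at[of d "ins q" ys] assms xs l by auto
  have "step p i (step q (i + outs p + d) g) xs =
      (\<Sum>cs | length cs = outs p. entry p as cs *
        step q (i + outs p + d) g ((us @ cs @ ms) @ bs @ vs))"
    using step_append[of us i as p _ ys] l by (simp add: xs ys)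
  also have "\<dots> = (\<Sum>cs | length cs = outs p. entry p as cs *
      (\<Sum>ds | length ds = outs q. entry q bs ds * g ((us @ cs @ ms) @ ds @ vs)))"
    by (intro sum.cong refl) (subst step_append, use l l' in auto)
  also have "\<dots> = (\<Sum>ds | length ds = outs q. entry q bs ds *
      (\<Sum>cs | length cs = outs p. entry p as cs * g (us @ cs @ ms @ ds @ vs)))"
    by (simp add: sum_distrib_left mult.left_commute) (rule sum.swap)
  also have "\<dots> = (\<Sum>ds | length ds = outs q. entry q bs ds * step p i g (us @ as @ ms @ ds @ vs))"
    by (intro sum.cong refl) (subst step_append, use l l' in auto)
  also have "\<dots> = step q (i + ins p + d) (step p i g) ((us @ as @ ms) @ bs @ vs)"
    by (subst step_append) (use l l' in auto)
  finally show ?thesis by (simp add: xs ys)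
qed

lemma split_list_1:
  assumes "i + 1 \<le> length xs"
  obtains us a vs where "xs = us @ a # vs" "length us = i"
proof -
  obtain us as vs where "xs = us @ as @ vs" "length us = i" "length as = 1"
    using split_at[OF assms] .
  moreover from this(3) obtain a where "as = [a]"
    by (auto simp: length_Suc_conv)
  ultimately show ?thesis by (intro that) simp_all
qed

lemma split_list_2:
  assumes "i + 2 \<le> length xs"
  obtains us a b vs where "xs = us @ a # b # vs" "length us = i"
proof -
  obtain us as vs where "xs = us @ as @ vs" "length us = i" "length as = 2"
    using split_at[OF assms] .
  moreover from this(3) obtain a b where "as = [a, b]"
    by (auto simp: length_Suc_conv numeral_2_eq_2)
  ultimately show ?thesis by (intro that) simp_all
qed

lemma split_list_3:
  assumes "i + 3 \<le> length xs"
  obtains us a b c vs where "xs = us @ a # b # c # vs" "length us = i"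
proof -
  obtain us as vs where "xs = us @ as @ vs" "length us = i" "length as = 3"
    using split_at[OF assms] .
  moreover from this(3) obtain a b c where "as = [a, b, c]"
    by (auto simp: length_Suc_conv numeral_3_eq_3)
  ultimately show ?thesis by (intro that) simp_all
qed

section \<open>Invariance under the local moves\<close>

lemma zigzag_down_act:
  assumes "i + 1 \<le> length xs"
  shows "step Lturn i (step Rturn (Suc i) g) xs = g xs"
proof -
  obtain us a vs where "xs = us @ a # vs" "length us = i"
    using assms by (rule split_list_1)
  then show ?thesis by (cases a) (simp_all add: step_pieces step_pieces_Suc)
qed

lemma zigzag_up_act:
  assumes "i + 1 \<le> length xs"
  shows "step Lturn (Suc i) (step Rturn i g) xs = g xs"
proof -
  obtain us a vs where "xs = us @ a # vs" "length us = i"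
    using assms by (rule split_list_1)
  then show ?thesis by (cases a) (simp_all add: step_pieces step_pieces_Suc)
qed

text \<open>By the zigzag identity the through smoothing on one side is the turning smoothing on the
  other. Their coefficients are therefore swapped, which is the passage from \<open>s\<close> to
  \<open>opposite s\<close>.\<close>

lemma slide_Lturn_act:
  assumes "i + 1 \<le> length xs"
  shows "step Lturn i (step (Crossing s) (Suc i) g) xs =
    step Lturn (Suc i) (step (Crossing (opposite s)) i g) xs"
proof -
  obtain us a vs where "xs = us @ a # vs" "length us = i"
    using assms by (rule split_list_1)
  then show ?thesis
    by (cases a; cases s)
      (simp_all add: step_pieces step_pieces_Suc add_divide_distrib diff_divide_distrib)
qed

lemma slide_Rturn_act:
  assumes "i + 3 \<le> length xs"
  shows "step (Crossing s) (Suc i) (step Rturn i g) xs =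
    step (Crossing (opposite s)) i (step Rturn (Suc i) g) xs"
proof -
  obtain us a b c vs where "xs = us @ a # b # c # vs" "length us = i"
    using assms by (rule split_list_3)
  then show ?thesis
    by (cases a; cases b; cases c; cases s) (simp_all add: step_pieces step_pieces_Suc)
qed

text \<open>The turning smoothing of the curl splits off a loop, and
  \<open>wt s + (- wt s ^ 2 - 1 / wt s ^ 2) / wt s = - 1 / wt s ^ 3\<close>.\<close>

lemma R1_Lturn_act:
  assumes "i \<le> length xs"
  shows "step Lturn i (step (Crossing s) i g) xs = - 1 / wt s ^ 3 * step Lturn i g xs"
proof -
  obtain us vs where "xs = us @ vs" "length us = i"
    using assms by (metis append_take_drop_id length_take min.absorb2)
  then show ?thesis by (cases s) (simp_all add: step_pieces field_simps)
qed

lemma R1_Rturn_act: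
  assumes "i + 2 \<le> length xs"
  shows "step (Crossing s) i (step Rturn i g) xs = - 1 / wt s ^ 3 * step Rturn i g xs"
proof -
  obtain us a b vs where "xs = us @ a # b # vs" "length us = i"
    using assms by (rule split_list_2)
  then show ?thesis by (cases a; cases b; cases s) (simp_all add: step_pieces power_one_over)
qed

text \<open>The cup-cap terms have total coefficient \<open>wt s ^ 2 + 1 / wt s ^ 2\<close> plus the
  loop value, which is zero.\<close>

lemma R2_act:
  assumes "i + 2 \<le> length xs"
  shows "step (Crossing s) i (step (Crossing (opposite s)) i g) xs = g xs"
proof -
  obtain us a b vs where "xs = us @ a # b # vs" "length us = i"
    using assms by (rule split_list_2)
  then show ?thesis by (cases a; cases b; cases s) (simp_all add: step_pieces field_simps)
qed

text \<open>An instance of the Yang-Baxter equation, checked on the eight labellings of three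
  strands for the six non-cyclic slope patterns.\<close>

lemma R3_act:
  assumes "i + 3 \<le> length xs" "b = a \<or> b = c"
  shows "step (Crossing a) i (step (Crossing b) (Suc i) (step (Crossing c) i g)) xs =
    step (Crossing c) (Suc i) (step (Crossing b) i (step (Crossing a) (Suc i) g)) xs"
proof -
  obtain us x y z vs where "xs = us @ x # y # z # vs" "length us = i"
    using assms(1) by (rule split_list_3)
  then show ?thesis using assms(2)
    by (cases x; cases y; cases z; cases a; cases b; cases c)
      (simp_all add: step_pieces step_pieces_Suc field_simps)
qed

text \<open>The factor \<open>c\<close> is fixed before the labels and \<open>g\<close>, so it can
  be pulled out of a whole diagram. A curl contributes \<open>- 1 / 8\<close> if its crossing is
  \<open>Positive\<close> and \<open>- 8\<close> if it is \<open>Negative\<close>.\<close>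

lemma act_local_move:
  assumes "local_move l r"
  obtains c where "c \<in> {1, - 8, - 1 / 8}"
    and "\<And>m m' xs g. tangle l m m' \<Longrightarrow> tangle r m m' \<Longrightarrow> length xs = m \<Longrightarrow>
      act l g xs = c * act r g xs"
proof -
  have "\<exists>c \<in> {1, - 8, - 1 / 8}. \<forall>m m' xs g. tangle l m m' \<longrightarrow> tangle r m m' \<longrightarrow>
      length xs = m \<longrightarrow> act l g xs = c * act r g xs"
    using assms
  proof cases
    case (exchange p i q d)
    show ?thesis unfolding exchange
      by (intro bexI[of _ 1]; clarsimp) (rule step_exchange, linarith)
  next
    case (zigzag_down i)
    then show ?thesis by (intro bexI[of _ 1]) (auto simp: zigzag_down_act)
  next
    case (zigzag_up i)
    then show ?thesis by (intro bexI[of _ 1]) (auto simp: zigzag_up_act)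
  next
    case (slide_Lturn i s)
    then show ?thesis by (intro bexI[of _ 1]) (auto simp: slide_Lturn_act)
  next
    case (slide_Rturn s i)
    then show ?thesis by (intro bexI[of _ 1]) (auto simp: slide_Rturn_act)
  next
    case (R1_Lturn i s)
    then show ?thesis
      by (intro bexI[of _ "- 1 / wt s ^ 3"]; cases s) (auto simp: R1_Lturn_act power_one_over)
  next
    case (R1_Rturn s i)
    then show ?thesis
      by (intro bexI[of _ "- 1 / wt s ^ 3"]; cases s) (auto simp: R1_Rturn_act power_one_over)
  next
    case (R2 s i)
    then show ?thesis by (intro bexI[of _ 1]) (auto simp: R2_act)
  next
    case (R3 b a c i)
    then show ?thesis by (intro bexI[of _ 1]) (auto simp: R3_act)
  qed
  then show ?thesis using that by blast
qed

text \<open>Both sides of a move are followed by the same picture \<open>v\<close>; this shows that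
  they have equally many right ends.\<close>

lemma tangle_injective: "tangle w m k \<Longrightarrow> tangle w m' k \<Longrightarrow> m = m'"
proof (induction w arbitrary: m m')
  case (Cons x w)
  obtain p i where [simp]: "x = (p, i)" by (cases x)
  have "m - ins p + outs p = m' - ins p + outs p"
    using Cons.prems by (intro Cons.IH) auto
  then show ?case using Cons.prems by auto
qed simp

lemma bracket_move:
  assumes "move D E"
  obtains c where "c \<in> {1, - 8, - 1 / 8}" and "bracket D = c * bracket E"
  using assms
proof cases
  case (1 l r u v)
  obtain c where c: "c \<in> {1, - 8, - 1 / 8}" and act:
    "\<And>m m' xs g. tangle l m m' \<Longrightarrow> tangle r m m' \<Longrightarrow> length xs = m \<Longrightarrow>
      act l g xs = c * act r g xs"
    using act_local_move[OF 1(3)] by blast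
  obtain m k where l: "tangle u 0 m" "tangle l m k" "tangle v k 0"
    using 1(4) by (auto simp: closed_picture_def tangle_append)
  obtain k' where r: "tangle r m k'" "tangle v k' 0"
    using 1(5) l(1) by (auto simp: closed_picture_def tangle_append dest: tangle_functional)
  have "k' = k"
    using l(3) r(2) by (rule tangle_injective[symmetric])
  then have "act l (act v g) ys = c * act r (act v g) ys" if "length ys = m" for g ys
    using act l(2) r(1) that by blast
  then have "bracket D = c * bracket E"
    unfolding bracket_def 1(1,2) act_simps
    by (intro act_cong_scaled[OF l(1)]) auto
  with c show ?thesis by (rule that)
qed

text \<open>Two exponents allow for powers of two in numerator and denominator alike. Sign and
  factors of \<open>8\<close> are forgotten, which is exactly the ambiguity caused by curls; zero
  has no odd part.\<close>

definition has_odd_part :: "rat \<Rightarrow> nat \<Rightarrow> bool" where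
  "has_odd_part x N \<longleftrightarrow> odd N \<and> (\<exists>i j. 2 ^ i * \<bar>x\<bar> = 2 ^ j * of_nat N)"

lemma odd_part_unique_nat:
  fixes M N :: nat
  assumes "2 ^ i * M = 2 ^ j * N" "odd M" "odd N"
  shows "M = N"
proof -
  have "M dvd N"
  proof -
    have "M dvd 2 ^ j * N" using assms(1) by (metis dvd_triv_right)
    then show ?thesis using assms(2) by (simp add: coprime_dvd_mult_right_iff)
  qed
  moreover have "N dvd M"
  proof -
    have "N dvd 2 ^ i * M" using assms(1) by (metis dvd_triv_right)
    then show ?thesis using assms(3) by (simp add: coprime_dvd_mult_right_iff)
  qed
  ultimately show ?thesis by (rule dvd_antisym)
qed

lemma has_odd_part_unique:
  assumes "has_odd_part x M" "has_odd_part x N"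
  shows "M = N"
proof -
  obtain i j where M: "2 ^ i * \<bar>x\<bar> = 2 ^ j * of_nat M" "odd M"
    using assms(1) by (auto simp: has_odd_part_def)
  obtain i' j' where N: "2 ^ i' * \<bar>x\<bar> = 2 ^ j' * of_nat N" "odd N"
    using assms(2) by (auto simp: has_odd_part_def)
  have "2 ^ i' * (2 ^ i * \<bar>x\<bar>) = 2 ^ i * (2 ^ i' * \<bar>x\<bar>)"
    by simp
  then have "(of_nat (2 ^ (i' + j) * M) :: rat) = of_nat (2 ^ (i + j') * N)"
    unfolding M(1) N(1) by (simp add: power_add mult.assoc)
  then have "2 ^ (i' + j) * M = 2 ^ (i + j') * N"
    by (simp only: of_nat_eq_iff)
  then show ?thesis using M(2) N(2) by (rule odd_part_unique_nat)
qed

lemma has_odd_part_mult_8: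
  "has_odd_part (8 * x) N \<longleftrightarrow> has_odd_part x N"
proof
  assume "has_odd_part (8 * x) N"
  then obtain i j where "2 ^ i * \<bar>8 * x\<bar> = 2 ^ j * of_nat N" "odd N"
    by (auto simp: has_odd_part_def)
  then have "2 ^ (i + 3) * \<bar>x\<bar> = 2 ^ j * of_nat N"
    by (simp add: power_add abs_mult mult.assoc)
  with \<open>odd N\<close> show "has_odd_part x N" unfolding has_odd_part_def by blast
next
  assume "has_odd_part x N"
  then obtain i j where "2 ^ i * \<bar>x\<bar> = 2 ^ j * of_nat N" "odd N"
    by (auto simp: has_odd_part_def)
  then have "2 ^ i * \<bar>8 * x\<bar> = 2 ^ (j + 3) * of_nat N"
    by (simp add: power_add abs_mult)
  with \<open>odd N\<close> show "has_odd_part (8 * x) N" unfolding has_odd_part_def by blast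
qed

lemma has_odd_part_minus [simp]: "has_odd_part (- x) N \<longleftrightarrow> has_odd_part x N"
  by (simp add: has_odd_part_def)

lemma has_odd_part_move:
  assumes "move D E"
  shows "has_odd_part (bracket D) N \<longleftrightarrow> has_odd_part (bracket E) N"
proof -
  obtain c where "c \<in> {1, - 8, - 1 / 8}" and "bracket D = c * bracket E"
    using bracket_move[OF assms] .
  \<comment> \<open>The instance at \<open>bracket E / 8\<close> treats the factor
    \<open>- 1 / 8\<close>.\<close>
  then show ?thesis
    using has_odd_part_mult_8[of "bracket E" N] has_odd_part_mult_8[of "bracket E / 8" N] by auto
qed

lemma has_odd_part_same_knot:
  assumes "same_knot D E"
  shows "has_odd_part (bracket D) N \<longleftrightarrow> has_odd_part (bracket E) N"
  using assms unfolding same_knot_def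
  by (induction rule: equivclp_induct) (auto simp: has_odd_part_move)

section \<open>Rows of crossings\<close>

definition row :: "slope list \<Rightarrow> diagram" where
  "row ss = [(Lturn, 0), (Lturn, 2)] @ map (\<lambda>s. (Crossing s, 1)) ss @ [(Rturn, 2), (Rturn, 0)]"

lemma resolve_free_foil: "resolve a (free_foil n) = row (map a [0..<n])"
  by (simp add: resolve_def free_foil_def row_def)

lemma left_foil_eq: "left_foil k = row (replicate k Positive)"
  and right_foil_eq: "right_foil k = row (replicate k Negative)"
  by (simp_all add: left_foil_def right_foil_def resolve_free_foil map_replicate_const)

lemma closed_picture_row: "closed_picture (row ss)"
  using closed_picture_free_foil[of "length ss"]
    closed_picture_resolve[of "\<lambda>j. ss ! j" "free_foil (length ss)"]
  by (simp add: resolve_free_foil map_nth)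

text \<open>Powers of the crossing operator are combinations of the identity and the cup-cap operator,
  of which a one-crossing curl is an eigenvector with eigenvalue \<open>- 1 / wt s ^ 3\<close>.\<close>

lemma act_replicate_Crossing:
  "act (replicate k (Crossing s, 1)) g [a, b, c, d] =
     wt s ^ k * g [a, b, c, d] + 4 / 17 * (wt s ^ k - (- 1 / wt s ^ 3) ^ k) *
       (cap b c * (g [a, True, False, d] / 2 - 2 * g [a, False, True, d]))"
proof (induction k arbitrary: b c)
  case (Suc k)
  \<comment> \<open>\<open>p\<close> and \<open>q\<close> are powers of the two eigenvalues of a
    crossing. As \<open>- 17 / 4\<close> is the loop value, \<open>- 4 / 17\<close> times the
    cup-cap operator is a projection, whence the constant \<open>4 / 17\<close>.\<close>
  define p q where "p = wt s ^ k" and "q = (- 1 / wt s ^ 3) ^ k"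
  define G where "G = g [a, True, False, d] / 2 - 2 * g [a, False, True, d]"
  have combine: "wt s * (p * x + 4 / 17 * (p - q) * (y * G)) + y / wt s * (q * G) =
      wt s * p * x + 4 / 17 * (wt s * p - - 1 / wt s ^ 3 * q) * (y * G)" for x y
    by (cases s) (simp_all add: power_one_over field_simps)
  have "act (replicate (Suc k) (Crossing s, 1)) g [a, b, c, d] =
      step (Crossing s) (length [a]) (act (replicate k (Crossing s, 1)) g) ([a] @ b # c # [d])"
    by simp
  also have "\<dots> = wt s * act (replicate k (Crossing s, 1)) g [a, b, c, d] +
      cap b c / wt s * (act (replicate k (Crossing s, 1)) g [a, True, False, d] / 2 -
        2 * act (replicate k (Crossing s, 1)) g [a, False, True, d])"
    by (subst step_pieces) simp_all
  \<comment> \<open>Contraction with the cup gives \<open>p * G - (p - q) * G\<close>, because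
    \<open>4 / 17\<close> cancels against the loop value.\<close>
  also have "act (replicate k (Crossing s, 1)) g [a, True, False, d] / 2 -
      2 * act (replicate k (Crossing s, 1)) g [a, False, True, d] = q * G"
    unfolding Suc p_def[symmetric] q_def[symmetric] G_def[symmetric]
    by (simp add: G_def algebra_simps diff_divide_distrib add_divide_distrib)
  also have "wt s * act (replicate k (Crossing s, 1)) g [a, b, c, d] + cap b c / wt s * (q * G) =
      wt s * p * g [a, b, c, d] + 4 / 17 * (wt s * p - - 1 / wt s ^ 3 * q) * (cap b c * G)"
    unfolding Suc p_def[symmetric] q_def[symmetric] G_def[symmetric]
    by (rule combine)
  finally show ?case
    unfolding p_def q_def G_def power_Suc .
qed simp

text \<open>Closing up the identity term gives two loops, \<open>289 / 16\<close>, and closing up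
  the cup-cap term gives one, \<open>- 17 / 4\<close>. So the coefficient of \<open>wt s ^ k\<close>
  is \<open>289 / 16 - 1\<close>.\<close>

lemma bracket_row_replicate:
  "bracket (row (replicate k s)) = 273 / 16 * wt s ^ k + (- 1 / wt s ^ 3) ^ k"
proof -
  define g where "g = step Rturn 2 (step Rturn 0 (\<lambda>_. 1))"
  have g: "g [a, b, c, d] = cap c d * cap a b" for a b c d
    using step_pieces(2)[of "[a, b]" 2 "step Rturn 0 (\<lambda>_. 1)" c d "[]"]
      step_pieces(2)[of "[]" 0 "\<lambda>_. 1" a b "[]"]
    by (simp add: g_def)
  define h where "h = act (replicate k (Crossing s, 1)) g"
  have "bracket (row (replicate k s)) = step Lturn 0 (step Lturn 2 h) []"
    by (simp add: bracket_def row_def h_def g_def map_replicate)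
  also have "\<dots> = step Lturn 2 h [True, False] / 2 - 2 * step Lturn 2 h [False, True]"
    using step_pieces(1)[of "[]" 0 _ "[]"] by simp
  also have "\<dots> = (h [True, False, True, False] / 2 - 2 * h [True, False, False, True]) / 2 -
      2 * (h [False, True, True, False] / 2 - 2 * h [False, True, False, True])"
    using step_pieces(1)[of "[True, False]" 2 h "[]"] step_pieces(1)[of "[False, True]" 2 h "[]"]
    by simp
  also have "\<dots> = 273 / 16 * wt s ^ k + (- 1 / wt s ^ 3) ^ k"
    unfolding h_def act_replicate_Crossing g by (simp add: field_simps)
  finally show ?thesis .
qed

text \<open>The general formulas fail at \<open>k = 1\<close>: the first gives the even number
  \<open>272 = 16 * 17\<close>, and \<open>256 - 273\<close> is negative.\<close>

fun foil_number :: "slope \<Rightarrow> nat \<Rightarrow> nat" where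
  "foil_number Positive k = (if k = 1 then 17 else 273 * 16 ^ (k - 1) - 1)"
| "foil_number Negative k = (if k = 1 then 17 else 16 ^ (k + 1) - 273)"

text \<open>For \<open>k\<close> at least 3, denominators are cleared by
  \<open>8 ^ k = 512 * r\<close> for positive slope and by \<open>16 * 2 ^ k = 128 * q\<close> for
  negative slope. Writing \<open>k = 2 * j + 3\<close> fixes the sign of
  \<open>(- 1) ^ k\<close>.\<close>

lemma has_odd_part_foil:
  assumes "odd k"
  shows "has_odd_part (bracket (row (replicate k s))) (foil_number s k)"
proof (cases "k = 1")
  case True
  have "2 ^ 0 * \<bar>bracket (row (replicate 1 Positive))\<bar> = 2 ^ 1 * of_nat 17"
    and "2 ^ 5 * \<bar>bracket (row (replicate 1 Negative))\<bar> = 2 ^ 0 * of_nat 17"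
    unfolding bracket_row_replicate by (simp_all add: power_one_over)
  moreover have "odd (17 :: nat)" by simp
  ultimately have "has_odd_part (bracket (row (replicate 1 s))) 17"
    unfolding has_odd_part_def by (cases s) blast+
  moreover have "foil_number s 1 = 17" by (cases s) simp_all
  ultimately show ?thesis by (simp only: True)
next
  case False
  with assms have "k = 2 * ((k - 3) div 2) + 3" by presburger
  then obtain j where k: "k = 2 * j + 3" by blast
  define P :: nat where "P = 16 ^ (2 * j)"
  have P: "P \<ge> 1" by (simp add: P_def)
  have P': "(8 :: rat) ^ (2 * j) * 2 ^ (2 * j) = of_nat P"
    by (simp add: P_def flip: power_mult_distrib)
  show ?thesis
  proof (cases s)
    case Positive
    define q r :: rat where "q = 2 ^ (2 * j)" and "r = 8 ^ (2 * j)"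
    have "r > 0" by (simp add: r_def)
    have "bracket (row (replicate k s)) = 273 / 2 * q - 1 / (512 * r)"
      by (simp add: bracket_row_replicate Positive k power_add power_divide q_def r_def)
    also have "512 * r * \<dots> = of_nat (69888 * P) - 1"
      using \<open>r > 0\<close> P' by (simp add: field_simps q_def r_def)
    also have "\<dots> = of_nat (foil_number s k)"
      using P by (simp add: Positive k power_add P_def[symmetric] of_nat_diff)
    finally have "2 ^ (9 + 6 * j) * bracket (row (replicate k s)) = of_nat (foil_number s k)"
      by (simp add: r_def power_add power_mult)
    then have "2 ^ (9 + 6 * j) * \<bar>bracket (row (replicate k s))\<bar> =
        2 ^ 0 * of_nat (foil_number s k)"
      by (metis abs_mult abs_numeral abs_of_nat mult_1 power_0 power_abs)
    moreover have "odd (foil_number s k)"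
      using P by (simp add: Positive k power_add P_def[symmetric])
    ultimately show ?thesis
      unfolding has_odd_part_def by blast
  next
    case Negative
    define q r :: rat where "q = 2 ^ (2 * j)" and "r = 8 ^ (2 * j)"
    have "q > 0" by (simp add: q_def)
    have "bracket (row (replicate k s)) = 273 / (128 * q) - 512 * r"
      by (simp add: bracket_row_replicate Negative k power_add power_divide q_def r_def)
    also have "128 * q * \<dots> = 273 - of_nat (65536 * P)"
      using \<open>q > 0\<close> P' by (simp add: field_simps q_def r_def)
    also have "\<dots> = - of_nat (foil_number s k)"
      using P by (simp add: Negative k power_add P_def[symmetric] of_nat_diff)
    finally have "2 ^ (7 + 2 * j) * bracket (row (replicate k s)) = - of_nat (foil_number s k)"
      by (simp add: q_def power_add power_mult)
    then have "2 ^ (7 + 2 * j) * \<bar>bracket (row (replicate k s))\<bar> =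
        2 ^ 0 * of_nat (foil_number s k)"
      by (metis abs_minus_cancel abs_mult abs_numeral abs_of_nat mult_1 power_0 power_abs)
    moreover have "odd (foil_number s k)"
      using P by (simp add: Negative k power_add P_def[symmetric])
    ultimately show ?thesis
      unfolding has_odd_part_def by blast
  qed
qed

lemma foil_number_inj:
  assumes "foil_number s k = foil_number s' k'" "odd k" "odd k'"
  shows "k = k' \<and> (k = 1 \<or> s = s')"
proof -
  \<comment> \<open>Adding the subtracted constant back avoids truncated subtraction and exposes the
    factor \<open>256\<close>.\<close>
  have form: "k = 1 \<and> foil_number s k = 17 \<or>
      (\<exists>j. k = j + 3 \<and> foil_number s k + (if s = Positive then 1 else 273) =
        (if s = Positive then 273 else 256) * 256 * 16 ^ j)" if "odd k" for s k
  proof (cases "k = 1")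
    case False
    with that have "k = (k - 3) + 3" by presburger
    then obtain j where k: "k = j + 3" by blast
    have "(1 :: nat) \<le> 16 ^ j" by simp
    then have "(273 :: nat) \<le> 65536 * 16 ^ j" by linarith
    then show ?thesis by (cases s) (auto simp: k power_add)
  qed (cases s; simp)
  have pos: "(1 :: nat) \<le> 16 ^ j" for j :: nat by simp
  consider "k = 1" "k' = 1" | "k = 1" "k' \<noteq> 1" | "k \<noteq> 1" "k' = 1"
    | j j' where "k = j + 3" "k' = j' + 3"
      "foil_number s k + (if s = Positive then 1 else 273) =
        (if s = Positive then 273 else 256) * 256 * 16 ^ j"
      "foil_number s' k' + (if s' = Positive then 1 else 273) =
        (if s' = Positive then 273 else 256) * 256 * 16 ^ j'"
    using form[OF assms(2), of s] form[OF assms(3), of s'] by auto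
  then show ?thesis
  proof cases
    case 2
    then obtain j where "17 + (if s' = Positive then 1 else 273) =
        (if s' = Positive then 273 else 256) * 256 * (16 :: nat) ^ j"
      using assms(1) form[OF assms(2), of s] form[OF assms(3), of s'] by auto
    moreover obtain P :: nat where "P = 16 ^ j" "1 \<le> P" using pos by blast
    \<comment> \<open>The left side is 18 or 290, the right side at least
      \<open>65536\<close>.\<close>
    ultimately have False by (cases s') simp_all
    then show ?thesis ..
  next
    case 3
    then obtain j where "17 + (if s = Positive then 1 else 273) =
        (if s = Positive then 273 else 256) * 256 * (16 :: nat) ^ j"
      using assms(1) form[OF assms(2), of s] form[OF assms(3), of s'] by auto
    moreover obtain P :: nat where "P = 16 ^ j" "1 \<le> P" using pos by blast
    ultimately have False by (cases s) simp_all
    then show ?thesis ..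
  next
    case (4 j j')
    define P P' :: nat where "P = 16 ^ j" and "P' = 16 ^ j'"
    have clash: False if "x + 1 = 273 * 256 * Q" "x + 273 = 256 * 256 * Q'" for x Q Q' :: nat
    proof -
      \<comment> \<open>The difference is 272, which is not a multiple of 256.\<close>
      have "256 dvd (x + 273) - (x + 1)"
        unfolding that by (intro dvd_diff_nat) simp_all
      then show False by simp
    qed
    have "s = s' \<and> P = P'"
      using 4(3,4) clash[of "foil_number s' k'" P P'] clash[of "foil_number s' k'" P' P]
      unfolding assms(1) P_def[symmetric] P'_def[symmetric]
      by (cases s; cases s'; simp del: foil_number.simps)
    then show ?thesis by (simp add: P_def P'_def 4)
  qed simp
qed

section \<open>Reduction of rows\<close>

fun slope_sign :: "slope \<Rightarrow> int" where
  "slope_sign Positive = 1"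
| "slope_sign Negative = - 1"

fun piece_sign :: "slope piece \<times> nat \<Rightarrow> int" where
  "piece_sign (Crossing s, i) = slope_sign s"
| "piece_sign _ = 0"

text \<open>This invariant of cancellation separates the left from the right 1-foil, which no knot
  invariant can do.\<close>

lemma cancel_pair_sign:
  assumes "cancel_pair\<^sup>*\<^sup>* D E"
  shows "sum_list (map piece_sign D) = sum_list (map piece_sign E)"
  using assms
proof induction
  case (step D E)
  have "sum_list (map piece_sign D) = sum_list (map piece_sign E)"
    using step(2) by cases (rename_tac u s i v, case_tac s; simp)
  with step show ?case by simp
qed simp

lemma sign_row: "sum_list (map piece_sign (row ss)) = sum_list (map slope_sign ss)"
  by (simp add: row_def comp_def)

text \<open>The tail is reduced first, with the head crossing absorbed into the arbitrary prefix
  \<open>u\<close>. The head then either extends the uniform row or cancels its first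
  crossing.\<close>

lemma cancel_pair_reduces:
  obtains k s where
    "cancel_pair\<^sup>*\<^sup>* (u @ map (\<lambda>s. (Crossing s, 1)) ss @ v) (u @ replicate k (Crossing s, 1) @ v)"
    "int k * slope_sign s = sum_list (map slope_sign ss)"
proof -
  have "\<exists>k s. cancel_pair\<^sup>*\<^sup>* (u @ map (\<lambda>s. (Crossing s, 1)) ss @ v)
        (u @ replicate k (Crossing s, 1) @ v) \<and>
      int k * slope_sign s = sum_list (map slope_sign ss)"
  proof (induction ss arbitrary: u)
    case Nil
    show ?case by (intro exI[of _ 0]) simp
  next
    case (Cons t ss)
    obtain k s where red: "cancel_pair\<^sup>*\<^sup>* (u @ map (\<lambda>s. (Crossing s, 1)) (t # ss) @ v)
        (u @ (Crossing t, 1) # replicate k (Crossing s, 1) @ v)"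
      and sign: "int k * slope_sign s = sum_list (map slope_sign ss)"
      using Cons[of "u @ [(Crossing t, 1)]"] by auto
    consider "k = 0" | "s = t" | j where "k = Suc j" "s = opposite t"
      by (cases k; cases s; cases t) auto
    then show ?case
    proof cases
      case 1
      with red sign show ?thesis by (intro exI[of _ 1] exI[of _ t]) simp
    next
      case 2
      with red sign show ?thesis
        by (intro exI[of _ "Suc k"] exI[of _ t]) (simp add: algebra_simps)
    next
      case 3
      have "cancel_pair (u @ (Crossing t, 1) # replicate k (Crossing s, 1) @ v)
          (u @ replicate j (Crossing s, 1) @ v)"
        using cancel_pair.intros[of u t 1 "replicate j (Crossing s, 1) @ v"] 3 by simp
      with red have "cancel_pair\<^sup>*\<^sup>* (u @ map (\<lambda>s. (Crossing s, 1)) (t # ss) @ v)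
          (u @ replicate j (Crossing s, 1) @ v)"
        by (rule rtranclp.rtrancl_into_rtrancl)
      with 3 sign[symmetric] show ?thesis
        by (intro exI[of _ j] exI[of _ s]) (cases t; simp add: algebra_simps)
    qed
  qed
  then show ?thesis using that by blast
qed

lemma row_reduces:
  obtains k s where "cancel_pair\<^sup>*\<^sup>* (row ss) (row (replicate k s))"
    and "int k * slope_sign s = sum_list (map slope_sign ss)"
  using cancel_pair_reduces[of "[(Lturn, 0), (Lturn, 2)]" ss "[(Rturn, 2), (Rturn, 0)]"]
  by (auto simp: row_def map_replicate)

section \<open>Classification of rows up to cancellation and up to isotopy\<close>

lemma cancel_pair_move:
  assumes "cancel_pair D E" "closed_picture D"
  shows "move D E" and "closed_picture E"
proof -
  from assms(1) obtain u s i v where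
    DE: "D = u @ [(Crossing s, i), (Crossing (opposite s), i)] @ v" "E = u @ [] @ v"
    by cases auto
  have "tangle [(Crossing s, i), (Crossing (opposite s), i)] m m' \<Longrightarrow> m' = m" for m m'
    by auto
  then show "closed_picture E"
    using assms(2) unfolding DE closed_picture_def tangle_append by fastforce
  then show "move D E"
    using assms(2) unfolding DE by (intro move.intros local_move.R2) auto
qed

text \<open>Each cancellation is an \<open>R2\<close> move; since \<open>move\<close> asks for
  closed pictures, closedness is carried along the chain.\<close>

lemma cancel_pair_same_knot:
  assumes "cancel_pair\<^sup>*\<^sup>* D E" "closed_picture D"
  shows "same_knot D E"
proof -
  have "same_knot D E \<and> closed_picture E"
    using assms
  proof induction
    case (step E F)
    then show ?case
      unfolding same_knot_def by (meson cancel_pair_move equivclp_into_equivclp)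
  qed (simp add: same_knot_def)
  then show ?thesis ..
qed

lemma same_knot_refl [simp]: "same_knot D D"
  by (simp add: same_knot_def)

lemma same_knot_sym: "same_knot D E \<Longrightarrow> same_knot E D"
  unfolding same_knot_def by (rule equivclp_sym)

lemma same_knot_trans: "same_knot D E \<Longrightarrow> same_knot E F \<Longrightarrow> same_knot D F"
  unfolding same_knot_def by (rule equivclp_trans)

lemma move_same_knot: "move D E \<Longrightarrow> same_knot D E"
  unfolding same_knot_def by auto

text \<open>Sliding across a right turning point makes the crossing a curl on the lower left turn;
  removing it leaves a zigzag.\<close>

lemma same_knot_row_1_unknot: "same_knot (row [s]) unknot"
proof -
  have closed: "closed_picture [(Lturn, 0), (Lturn, 2), (Crossing t, 1), (Rturn, 2), (Rturn, 0)]"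
    "closed_picture [(Lturn, 0), (Lturn, 2), (Crossing t, 2), (Rturn, 1), (Rturn, 0)]"
    "closed_picture [(Lturn, 0), (Lturn, 2), (Rturn, 1), (Rturn, 0)]"
    "closed_picture [(Lturn, 0), (Rturn, 0)]" for t :: slope
    by (simp_all add: closed_picture_def)
  define t where "t = opposite s"
  have s: "s = opposite t" by (cases s) (simp_all add: t_def)
  \<comment> \<open>The slide rule leads from the curl to the row, so this move is later used
    backwards.\<close>
  have "move [(Lturn, 0), (Lturn, 2), (Crossing t, 2), (Rturn, 1), (Rturn, 0)] (row [s])"
    using move.intros[OF local_move.slide_Rturn[of t 1], of "[(Lturn, 0), (Lturn, 2)]" "[(Rturn, 0)]"]
      closed by (simp add: row_def s numeral_2_eq_2)
  moreover have "move [(Lturn, 0), (Lturn, 2), (Crossing t, 2), (Rturn, 1), (Rturn, 0)]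
      [(Lturn, 0), (Lturn, 2), (Rturn, 1), (Rturn, 0)]"
    using move.intros[OF local_move.R1_Lturn[of 2 t], of "[(Lturn, 0)]" "[(Rturn, 1), (Rturn, 0)]"]
      closed by simp
  moreover have "move [(Lturn, 0), (Lturn, 2), (Rturn, 1), (Rturn, 0)] unknot"
    using move.intros[OF local_move.zigzag_up[of 1], of "[(Lturn, 0)]" "[(Rturn, 0)]"]
      closed by (simp add: unknot_def numeral_2_eq_2)
  ultimately show ?thesis
    by (meson move_same_knot same_knot_sym same_knot_trans)
qed

lemma same_knot_foils_iff:
  assumes "odd k" "odd k'"
  shows "same_knot (row (replicate k s)) (row (replicate k' s')) \<longleftrightarrow>
    k = k' \<and> (k = 1 \<or> s = s')"
proof
  assume "same_knot (row (replicate k s)) (row (replicate k' s'))"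
  then have "has_odd_part (bracket (row (replicate k' s'))) (foil_number s k)"
    using has_odd_part_foil[OF assms(1)] by (simp only: has_odd_part_same_knot[symmetric])
  then have "foil_number s k = foil_number s' k'"
    using has_odd_part_foil[OF assms(2)] by (rule has_odd_part_unique)
  then show "k = k' \<and> (k = 1 \<or> s = s')"
    using assms by (rule foil_number_inj)
next
  assume "k = k' \<and> (k = 1 \<or> s = s')"
  then show "same_knot (row (replicate k s)) (row (replicate k' s'))"
    using same_knot_trans[OF same_knot_row_1_unknot[of s] same_knot_row_1_unknot[of s', THEN same_knot_sym]]
    by auto
qed

text \<open>The row first cancels down to a uniform one. For \<open>k = 1\<close> the signed count
  then decides, for larger \<open>k\<close> the bracket does.\<close>

lemma produces_row_iff:
  assumes "odd (sum_list (map slope_sign ss))" "odd k"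
  shows "produces (row ss) (row (replicate k s)) k \<longleftrightarrow>
    sum_list (map slope_sign ss) = int k * slope_sign s"
proof -
  obtain k' s' where red: "cancel_pair\<^sup>*\<^sup>* (row ss) (row (replicate k' s'))"
    and sign: "int k' * slope_sign s' = sum_list (map slope_sign ss)"
    by (rule row_reduces)
  have "odd k'" using assms(1) unfolding sign[symmetric] by (cases s') auto
  \<comment> \<open>For positive \<open>k'\<close> the product \<open>int k' * slope_sign s'\<close>
    determines both factors.\<close>
  then have "k' > 0" by (rule odd_pos)
  show ?thesis
  proof (cases "k = 1")
    case True
    have "cancel_pair\<^sup>*\<^sup>* (row ss) (row [s]) \<longleftrightarrow> sum_list (map slope_sign ss) = slope_sign s"
    proof
      assume "cancel_pair\<^sup>*\<^sup>* (row ss) (row [s])"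
      then show "sum_list (map slope_sign ss) = slope_sign s"
        by (drule_tac cancel_pair_sign) (simp add: sign_row)
    next
      assume "sum_list (map slope_sign ss) = slope_sign s"
      then have "k' = 1 \<and> s' = s"
        using sign by (cases s; cases s') auto
      then show "cancel_pair\<^sup>*\<^sup>* (row ss) (row [s])"
        using red by simp
    qed
    with True show ?thesis by (simp add: produces_def)
  next
    case False
    have "same_knot (row ss) (row (replicate k' s'))"
      using red closed_picture_row by (rule cancel_pair_same_knot)
    then have "same_knot (row ss) (row (replicate k s)) \<longleftrightarrow>
        same_knot (row (replicate k' s')) (row (replicate k s))"
      by (meson same_knot_sym same_knot_trans)
    also have "\<dots> \<longleftrightarrow> k' = k \<and> s' = s"
      using False \<open>odd k'\<close> assms(2) by (auto simp: same_knot_foils_iff)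
    also have "\<dots> \<longleftrightarrow> sum_list (map slope_sign ss) = int k * slope_sign s"
      using \<open>k' > 0\<close> unfolding sign[symmetric] by (cases s; cases s') auto
    finally show ?thesis using False by (simp add: produces_def)
  qed
qed

lemma same_knot_row_unknot_iff:
  assumes "odd (sum_list (map slope_sign ss))"
  shows "same_knot (row ss) unknot \<longleftrightarrow> \<bar>sum_list (map slope_sign ss)\<bar> = 1"
proof -
  obtain k s where red: "cancel_pair\<^sup>*\<^sup>* (row ss) (row (replicate k s))"
    and sign: "int k * slope_sign s = sum_list (map slope_sign ss)"
    by (rule row_reduces)
  have "odd k" using assms unfolding sign[symmetric] by (cases s) auto
  have "same_knot (row ss) (row (replicate k s))"
    using red closed_picture_row by (rule cancel_pair_same_knot)
  \<comment> \<open>The unknot is represented by the 1-foil of slope \<open>s\<close>, so that the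
    comparison of foils applies.\<close>
  then have "same_knot (row ss) unknot \<longleftrightarrow>
      same_knot (row (replicate k s)) (row (replicate 1 s))"
    using same_knot_row_1_unknot[of s] by (simp, meson same_knot_sym same_knot_trans)
  also have "\<dots> \<longleftrightarrow> k = 1"
    using \<open>odd k\<close> by (auto simp: same_knot_foils_iff simp del: replicate_Suc One_nat_def)
  also have "\<dots> \<longleftrightarrow> \<bar>sum_list (map slope_sign ss)\<bar> = 1"
    unfolding sign[symmetric] by (cases s) auto
  finally show ?thesis .
qed

section \<open>Counting\<close>

lemma UNIV_slope: "(UNIV :: slope set) = {Positive, Negative}"
  by (auto intro: slope.exhaust)

lemma sign_assignment:
  "sum_list (map slope_sign (map a [0..<n])) = 2 * int (card {i. i < n \<and> a i = Positive}) - int n"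
proof (induction n)
  case (Suc n)
  have "{i. i < Suc n \<and> a i = Positive} =
      (if a n = Positive then insert n {i. i < n \<and> a i = Positive} else {i. i < n \<and> a i = Positive})"
    by (auto simp: less_Suc_eq)
  then show ?case using Suc by (cases "a n") auto
qed simp

lemma card_assignments_Positive:
  "card {a \<in> assignments n. card {i. i < n \<and> a i = Positive} = p} = n choose p"
proof -
  have "bij_betw (\<lambda>a. {i. i < n \<and> a i = Positive})
      {a \<in> assignments n. card {i. i < n \<and> a i = Positive} = p} {B. B \<subseteq> {..<n} \<and> card B = p}"
  proof (rule bij_betw_byWitness)
    \<comment> \<open>The restricted abstraction is \<open>undefined\<close> outside
      \<open>{..<n}\<close>, as membership in \<open>assignments n\<close> demands.\<close>
    let ?f = "\<lambda>B. \<lambda>i\<in>{..<n}. if i \<in> B then Positive else Negative"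
    show "\<forall>a\<in>{a \<in> assignments n. card {i. i < n \<and> a i = Positive} = p}.
        ?f {i. i < n \<and> a i = Positive} = a"
      by (auto simp: assignments_def PiE_def extensional_def fun_eq_iff intro: slope.exhaust)
    have *: "{i. i < n \<and> ?f B i = Positive} = B" if "B \<subseteq> {..<n}" for B
      using that by (auto split: if_splits)
    then show "\<forall>B\<in>{B. B \<subseteq> {..<n} \<and> card B = p}. {i. i < n \<and> ?f B i = Positive} = B"
      by blast
    show "?f ` {B. B \<subseteq> {..<n} \<and> card B = p} \<subseteq>
        {a \<in> assignments n. card {i. i < n \<and> a i = Positive} = p}"
      using * by (auto simp: assignments_def PiE_def extensional_def)
  qed auto
  then show ?thesis
    using n_subsets[of "{..<n}" p] by (simp add: bij_betw_same_card)
qed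

lemma card_assignments_sign:
  assumes "odd n" "odd k" "k \<le> n"
  shows "card {a \<in> assignments n. sum_list (map slope_sign (map a [0..<n])) = int k * slope_sign s} =
    n choose ((n - k) div 2)"
proof (cases s)
  case Positive
  have "2 * int p - int n = int k \<longleftrightarrow> p = (n + k) div 2" for p
    using assms by presburger
  \<comment> \<open>A sum of \<open>k\<close> needs \<open>(n + k) div 2\<close> positive crossings;
    symmetry gives the stated binomial coefficient.\<close>
  moreover have "n choose ((n + k) div 2) = n choose (n - (n + k) div 2)"
    using assms by (intro binomial_symmetric) auto
  moreover have "n - (n + k) div 2 = (n - k) div 2"
    using assms by presburger
  ultimately show ?thesis
    using card_assignments_Positive[of n] by (simp add: Positive sign_assignment del: map_map)
next
  case Negative
  have "2 * int p - int n = - int k \<longleftrightarrow> p = (n - k) div 2" for p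
    using assms by presburger
  then show ?thesis
    using card_assignments_Positive[of n] by (simp add: Negative sign_assignment del: map_map)
qed

theorem theorem4p5:
  fixes n k :: nat
  assumes "n \<ge> 1" and "odd n" and "odd k" and "1 \<le> k" and "k \<le> n"
  shows "card (assignments n) = 2 ^ n
    \<and> card {a \<in> assignments n. produces (resolve a (free_foil n)) (left_foil k) k}
        = n choose ((n - k) div 2)
    \<and> card {a \<in> assignments n. produces (resolve a (free_foil n)) (right_foil k) k}
        = n choose ((n - k) div 2)
    \<and> same_knot (left_foil 1) unknot
    \<and> same_knot (right_foil 1) unknot
    \<and> card {a \<in> assignments n. same_knot (resolve a (free_foil n)) unknot}
        = 2 * (n choose ((n - 1) div 2))"
proof (intro conjI)
  let ?sign = "\<lambda>a. sum_list (map slope_sign (map a [0..<n]))"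
  have odd_sign: "odd (?sign a)" for a
    unfolding sign_assignment using assms(2) by simp
  note count = card_assignments_sign[OF assms(2)]
  have fin: "finite (assignments n)"
    unfolding assignments_def by (intro finite_PiE) (auto simp: UNIV_slope)
  show "card (assignments n) = 2 ^ n"
    by (simp add: assignments_def card_PiE UNIV_slope numeral_2_eq_2)
  show "card {a \<in> assignments n. produces (resolve a (free_foil n)) (left_foil k) k}
      = n choose ((n - k) div 2)"
    using count[OF assms(3,5), of Positive]
    by (simp only: resolve_free_foil left_foil_eq produces_row_iff[OF odd_sign assms(3)])
  show "card {a \<in> assignments n. produces (resolve a (free_foil n)) (right_foil k) k}
      = n choose ((n - k) div 2)"
    using count[OF assms(3,5), of Negative]
    by (simp only: resolve_free_foil right_foil_eq produces_row_iff[OF odd_sign assms(3)])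
  show "same_knot (left_foil 1) unknot" "same_knot (right_foil 1) unknot"
    by (simp_all add: left_foil_eq right_foil_eq same_knot_row_1_unknot)
  \<comment> \<open>The unknot arises from the signed counts 1 and -1, which are exclusive, so the
    two cases of \<open>k = 1\<close> add up.\<close>
  have "{a \<in> assignments n. same_knot (resolve a (free_foil n)) unknot} =
      {a \<in> assignments n. ?sign a = int 1 * slope_sign Positive} \<union>
      {a \<in> assignments n. ?sign a = int 1 * slope_sign Negative}"
    unfolding resolve_free_foil same_knot_row_unknot_iff[OF odd_sign] by auto
  also have "card \<dots> = card {a \<in> assignments n. ?sign a = int 1 * slope_sign Positive} +
      card {a \<in> assignments n. ?sign a = int 1 * slope_sign Negative}"
    using fin by (intro card_Un_disjoint) auto
  also have "\<dots> = 2 * (n choose ((n - 1) div 2))"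
    using count[OF _ assms(1), of Positive] count[OF _ assms(1), of Negative] by (simp del: map_map)
  finally show "card {a \<in> assignments n. same_knot (resolve a (free_foil n)) unknot}
      = 2 * (n choose ((n - 1) div 2))" .
qed

end
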